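(* Let $S=\langle n_1,n_2,n_3,n_4\rangle$ be a $4$-generated pseudo symmetric numerical semigroup with defining integers $\alpha_1,\alpha_2,\alpha_3,\alpha_4,\alpha_{21}$. Let $f_1=X_1^{\alpha_1}-X_3X_4^{\alpha_4-1}$, $f_2=X_2^{\alpha_2}-X_1^{\alpha_{21}}X_4$, $f_3=X_3^{\alpha_3}-X_1^{\alpha_1-\alpha_{21}-1}X_2$, $f_4=X_4^{\alpha_4}-X_1X_2^{\alpha_2-1}X_3^{\alpha_3-1}$, $f_5=X_3^{\alpha_3-1}X_1^{\alpha_{21}+1}-X_2X_4^{\alpha_4-1}$. Then the set of indispensable binomials of $I_S$ (up to sign) is $\{f_1,f_2,f_3,f_4,f_5\}$ if $\alpha_1-\alpha_{21}>2$, and is $\{f_1,f_2,f_3,f_5\}$ if $\alpha_1-\alpha_{21}=2$.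
   Context: Setting. $n_1,\dots,n_4$ are positive integers with $\gcd(n_1,\dots,n_4)=1$, and $S=\langle n_1,\dots,n_4\rangle=\{u_1n_1+\cdots+u_4n_4 \mid u_i\in\mathbb N\}$ ($0\in\mathbb N$) is the numerical semigroup they generate; $S$ is $4$-generated, i.e. $n_1,\dots,n_4$ is its minimal generating set. The set of pseudo Frobenius numbers is $PF(S)=\{n\in\mathbb Z\setminus S \mid n+s\in S \text{ for all } s\in S\setminus\{0\}\}$, and $g(S)=\max PF(S)$ is the Frobenius number. $S$ is pseudo symmetric if $PF(S)=\{g(S)/2,g(S)\}$. By a theorem of Komeda, for $S$ pseudo symmetric the generators can be labelled so that there are integers $\alpha_i>1$ ($1\le i\le 4$) and $\alpha_{21}$ with $0<\alpha_{21}<\alpha_1$ such that $n_1=\alpha_2\alpha_3(\alpha_4-1)+1$, $n_2=\alpha_{21}\alpha_3\alpha_4+(\alpha_1-\alpha_{21}-1)(\alpha_3-1)+\alpha_3$, $n_3=\alpha_1\alpha_4+(\alpha_1-\alpha_{21}-1)(\alpha_2-1)(\alpha_4-1)-\alpha_4+1$, $n_4=\alpha_1\alpha_2(\alpha_3-1)+\alpha_{21}(\alpha_2-1)+\alpha_2$. Such a labelling and such integers (the defining integers of $S$) are fixed. Minimality of the generating set forces $\alpha_1-\alpha_{21}\ge 2$. Let $K$ be a field, $A=K[X_1,\dots,X_4]$, and let $I_S$ be the kernel of $A\to K[t^{n_1},\dots,t^{n_4}]$, $X_i\mapsto t^{n_i}$. A binomial in $I_S$ is a difference of two distinct monomials lying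 in $I_S$. A binomial of $I_S$ is indispensable if it appears, up to sign, in every minimal generating set of $I_S$ consisting of binomials. *)

theory Defs
  imports Complex_Main "HOL-Library.Poly_Mapping" "HOL-Library.Numeral_Type"
    "HOL-Computational_Algebra.Polynomial"
begin

text \<open>
  Indices are taken in the numeral type \<^typ>\<open>4\<close>, whose four elements are 1, 2, 3, 4
  (with 4 = 0 in that type).
\<close>

definition semigroup_gen :: "(4 \<Rightarrow> nat) \<Rightarrow> 4 set \<Rightarrow> nat set" where
  "semigroup_gen n J = {(\<Sum>i\<in>J. u i * n i) | u :: 4 \<Rightarrow> nat. True}"

abbreviation numerical_semigroup :: "(4 \<Rightarrow> nat) \<Rightarrow> nat set" where
  "numerical_semigroup n \<equiv> semigroup_gen n UNIV"

text \<open>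
  Minimality is stated for the family of generators: no proper subfamily generates the
  same semigroup. In particular the generators are pairwise distinct.
\<close>

definition four_generated :: "(4 \<Rightarrow> nat) \<Rightarrow> bool" where
  "four_generated n \<longleftrightarrow>
     (\<forall>i. n i > 0) \<and> Gcd (range n) = 1 \<and>
     (\<forall>J. J \<subset> UNIV \<longrightarrow> semigroup_gen n J \<noteq> numerical_semigroup n)"

definition pseudo_frobenius :: "nat set \<Rightarrow> int set" where
  "pseudo_frobenius S =
     {x. x \<notin> int ` S \<and> (\<forall>s\<in>S - {0}. x + int s \<in> int ` S)}"

definition frobenius_number :: "nat set \<Rightarrow> int" where
  "frobenius_number S = Max (pseudo_frobenius S)"

definition pseudo_symmetric :: "nat set \<Rightarrow> bool" where
  "pseudo_symmetric S \<longleftrightarrow>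
     even (frobenius_number S) \<and>
     pseudo_frobenius S = {frobenius_number S div 2, frobenius_number S}"

text \<open>Komeda's parametrisation, stated over the integers to avoid truncated subtraction.\<close>

definition defining_integers :: "(4 \<Rightarrow> nat) \<Rightarrow> (4 \<Rightarrow> nat) \<Rightarrow> nat \<Rightarrow> bool" where
  "defining_integers n \<alpha> \<alpha>21 \<longleftrightarrow>
     (\<forall>i. \<alpha> i > 1) \<and> 0 < \<alpha>21 \<and> \<alpha>21 < \<alpha> 1 \<and>
     (let a1 = int (\<alpha> 1); a2 = int (\<alpha> 2); a3 = int (\<alpha> 3); a4 = int (\<alpha> 4); a21 = int \<alpha>21 in
        int (n 1) = a2 * a3 * (a4 - 1) + 1 \<and>
        int (n 2) = a21 * a3 * a4 + (a1 - a21 - 1) * (a3 - 1) + a3 \<and>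
        int (n 3) = a1 * a4 + (a1 - a21 - 1) * (a2 - 1) * (a4 - 1) - a4 + 1 \<and>
        int (n 4) = a1 * a2 * (a3 - 1) + a21 * (a2 - 1) + a2)"

text \<open>
  \<open>K[X\<^sub>1, \<dots>, X\<^sub>4]\<close> is the monoid algebra over \<open>K\<close> of the exponent vectors
  \<open>4 \<Rightarrow>\<^sub>0 nat\<close>, with the convolution product of finitely supported functions.
\<close>

type_synonym 'k mpoly4 = "(4 \<Rightarrow>\<^sub>0 nat) \<Rightarrow>\<^sub>0 'k"

definition monomial :: "(4 \<Rightarrow>\<^sub>0 nat) \<Rightarrow> 'k::field mpoly4" where
  "monomial m = Poly_Mapping.single m 1"

definition X :: "4 \<Rightarrow> 'k::field mpoly4" where
  "X i = monomial (Poly_Mapping.single i 1)"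

definition toric_map :: "(4 \<Rightarrow> nat) \<Rightarrow> 'k::field mpoly4 \<Rightarrow> 'k poly" where
  "toric_map n p =
     (\<Sum>m\<in>Poly_Mapping.keys p.
        Polynomial.smult (Poly_Mapping.lookup p m)
          (\<Prod>i\<in>UNIV. Polynomial.monom 1 (n i) ^ Poly_Mapping.lookup m i))"

definition toric_ideal :: "(4 \<Rightarrow> nat) \<Rightarrow> 'k::field mpoly4 set" where
  "toric_ideal n = {p. toric_map n p = 0}"

text \<open>The ideal generated by a set is its span in the ring regarded as a module over itself.\<close>

definition ideal_gen :: "'a::comm_ring_1 set \<Rightarrow> 'a set" where
  "ideal_gen G = module.span (*) G"

definition binomials :: "(4 \<Rightarrow> nat) \<Rightarrow> 'k::field mpoly4 set" where
  "binomials n = {monomial u - monomial v | u v. u \<noteq> v} \<inter> toric_ideal n"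

definition minimal_binomial_gens :: "(4 \<Rightarrow> nat) \<Rightarrow> 'k::field mpoly4 set \<Rightarrow> bool" where
  "minimal_binomial_gens n G \<longleftrightarrow>
     G \<subseteq> binomials n \<and> ideal_gen G = toric_ideal n \<and>
     (\<forall>G'. G' \<subset> G \<longrightarrow> ideal_gen G' \<noteq> toric_ideal n)"

definition indispensable :: "(4 \<Rightarrow> nat) \<Rightarrow> 'k::field mpoly4 \<Rightarrow> bool" where
  "indispensable n f \<longleftrightarrow>
     f \<in> binomials n \<and> (\<forall>G. minimal_binomial_gens n G \<longrightarrow> f \<in> G \<or> - f \<in> G)"

text \<open>
  Sets of binomials up to sign are represented by their closure under negation.
\<close>

definition up_to_sign :: "'a::ab_group_add set \<Rightarrow> 'a set" where
  "up_to_sign F = F \<union> uminus ` F"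

end

theory Submission imports Defs begin

text \<open>
  The degree of a monomial is its weight \<open>u\<^sub>1 n\<^sub>1 + \<dots> + u\<^sub>4 n\<^sub>4\<close>, and a binomial lies in
  \<open>I\<^sub>S\<close> exactly when its two monomials have the same weight. Read each \<open>f\<^sub>i\<close> as a rewriting
  rule in the direction that increases the exponent of \<open>X\<^sub>1\<close>:
  \<open>X\<^sub>3 X\<^sub>4^(\<alpha>\<^sub>4-1) \<rightarrow> X\<^sub>1^\<alpha>\<^sub>1\<close>, \<open>X\<^sub>2^\<alpha>\<^sub>2 \<rightarrow> X\<^sub>1^\<alpha>\<^sub>2\<^sub>1 X\<^sub>4\<close>, and so on. The rules preserve
  the weight, so the exponent of \<open>X\<^sub>1\<close> is bounded and rewriting terminates. The irreducible
  monomials are \<open>X\<^sub>1^k w\<close> with \<open>w\<close> among \<open>\<alpha>\<^sub>2 \<alpha>\<^sub>3 (\<alpha>\<^sub>4 - 1) + 1 = n\<^sub>1\<close> monomials in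
  \<open>X\<^sub>2, X\<^sub>3, X\<^sub>4\<close>. Since the generators are coprime, the weights of monomials meet every residue
  class modulo \<open>n\<^sub>1\<close>, hence so do the weights of these \<open>n\<^sub>1\<close> monomials \<open>w\<close>, and by counting
  each class is met once. So an irreducible monomial is determined by its weight
  (\<open>irreducible_unique\<close>), and all monomials of a given weight rewrite to the same irreducible
  one. This has two consequences.

  First, \<open>f\<^sub>1, \<dots>, f\<^sub>5\<close> generate \<open>I\<^sub>S\<close> (\<open>toric_ideal_generated\<close>). Any finite generating set of
  binomials contains a minimal one, hence contains every indispensable binomial up to sign
  (\<open>indispensable_in_generating_set\<close>), so no binomial other than the \<open>f\<^sub>i\<close> can be
  indispensable.

  Second, the monomials with the weight of \<open>f\<^sub>i\<close> are found by following the rules backwards from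
  the right-hand side of the rule of \<open>f\<^sub>i\<close>, which is irreducible. For \<open>f\<^sub>1, f\<^sub>2, f\<^sub>3, f\<^sub>5\<close>, and for
  \<open>f\<^sub>4\<close> if \<open>\<alpha>\<^sub>1 - \<alpha>\<^sub>2\<^sub>1 > 2\<close>, the only rule that produces it is the rule of \<open>f\<^sub>i\<close> itself, and
  the left-hand side, being free of \<open>X\<^sub>1\<close>, is produced by no rule. So only the two monomials of
  \<open>f\<^sub>i\<close> have this weight; they are coprime, and this makes \<open>f\<^sub>i\<close> indispensable
  (\<open>indispensable_if_two_element_fibre\<close>).

  If \<open>\<alpha>\<^sub>1 - \<alpha>\<^sub>2\<^sub>1 = 2\<close>, then \<open>f\<^sub>3 = X\<^sub>3^\<alpha>\<^sub>3 - X\<^sub>1 X\<^sub>2\<close> also rewrites the second monomial of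
  \<open>f\<^sub>4\<close>, so \<open>f\<^sub>4\<close> can be replaced by \<open>X\<^sub>4^\<alpha>\<^sub>4 - X\<^sub>2^(\<alpha>\<^sub>2-2) X\<^sub>3^(2\<alpha>\<^sub>3-1)\<close> in the generating
  set and is not indispensable.
\<close>

section \<open>Exponent vectors, weights and monomials\<close>

text \<open>
  Coordinates for exponent vectors: with them, divisibility of monomials and equality of products
  become arithmetic of four natural numbers, which the simplifier decides.
\<close>

definition expo :: "nat \<Rightarrow> nat \<Rightarrow> nat \<Rightarrow> nat \<Rightarrow> (4 \<Rightarrow>\<^sub>0 nat)" where
  "expo a b c d = Poly_Mapping.single 1 a + Poly_Mapping.single 2 b
     + Poly_Mapping.single 3 c + Poly_Mapping.single 4 d"

definition weight :: "(4 \<Rightarrow> nat) \<Rightarrow> (4 \<Rightarrow>\<^sub>0 nat) \<Rightarrow> nat" where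
  "weight n m = (\<Sum>i\<in>UNIV. Poly_Mapping.lookup m i * n i)"

lemma UNIV_num4: "(UNIV :: 4 set) = {1, 2, 3, 4}"
  by (rule sym, rule card_subset_eq) simp_all

lemma lookup_expo [simp]:
  "Poly_Mapping.lookup (expo a b c d) 1 = a"
  "Poly_Mapping.lookup (expo a b c d) 2 = b"
  "Poly_Mapping.lookup (expo a b c d) 3 = c"
  "Poly_Mapping.lookup (expo a b c d) 4 = d"
  by (simp_all add: expo_def lookup_add lookup_single)

lemma expo_eq_iff [simp]:
  "expo a b c d = expo a' b' c' d' \<longleftrightarrow> a = a' \<and> b = b' \<and> c = c' \<and> d = d'"
  by (metis lookup_expo)

lemma expo_cases:
  obtains a b c d where "m = expo a b c d"
proof
  let ?m = "Poly_Mapping.lookup m"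
  show "m = expo (?m 1) (?m 2) (?m 3) (?m 4)"
  proof (rule poly_mapping_eqI)
    fix i :: 4
    have "i \<in> {1, 2, 3, 4}"
      using UNIV_num4 by blast
    then show "?m i = Poly_Mapping.lookup (expo (?m 1) (?m 2) (?m 3) (?m 4)) i"
      by (auto simp del: One_nat_def)
  qed
qed

lemma expo_add [simp]:
  "expo a b c d + expo a' b' c' d' = expo (a + a') (b + b') (c + c') (d + d')"
  by (simp add: expo_def single_add algebra_simps)

lemma expo_0 [simp]: "expo 0 0 0 0 = 0"
  by (simp add: expo_def)

lemma weight_expo: "weight n (expo a b c d) = a * n 1 + b * n 2 + c * n 3 + d * n 4"
  unfolding weight_def UNIV_num4 by simp

lemma weight_add: "weight n (u + v) = weight n u + weight n v"
  by (simp add: weight_def lookup_add distrib_right sum.distrib)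

lemma monomial_mult: "monomial u * monomial v = monomial (u + v)"
  by (simp add: monomial_def mult_single)

lemma X_power: "X i ^ k = monomial (Poly_Mapping.single i k)"
proof (induction k)
  case (Suc k)
  then show ?case
    by (simp add: X_def monomial_mult flip: single_add)
qed (simp add: monomial_def)

lemma lookup_monomial: "Poly_Mapping.lookup (monomial u) v = (if u = v then 1 else 0)"
  by (simp add: monomial_def lookup_single when_def)

section \<open>The toric ideal\<close>

lemma poly_mapping_sum_singles:
  "p = (\<Sum>m\<in>Poly_Mapping.keys p. Poly_Mapping.single m (Poly_Mapping.lookup p m))"
  by (rule poly_mapping_eqI)
    (auto simp: lookup_sum lookup_single when_def in_keys_iff)

lemma toric_map_weight:
  assumes "finite A" "Poly_Mapping.keys p \<subseteq> A"
  shows "toric_map n p = (\<Sum>m\<in>A. monom (Poly_Mapping.lookup p m) (weight n m))"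
proof -
  have "(\<Prod>i\<in>UNIV. monom (1::'a) (n i) ^ Poly_Mapping.lookup m i) = monom 1 (weight n m)" for m
  proof -
    have "(\<Prod>i\<in>I. monom (1::'a) (n i) ^ Poly_Mapping.lookup m i)
        = monom 1 (\<Sum>i\<in>I. Poly_Mapping.lookup m i * n i)" if "finite I" for I
      using that
      by (induction I rule: finite_induct) (simp_all add: monom_power mult_monom mult.commute)
    then show ?thesis
      by (simp add: weight_def)
  qed
  then have "toric_map n p
      = (\<Sum>m\<in>Poly_Mapping.keys p. monom (Poly_Mapping.lookup p m) (weight n m))"
    by (simp add: toric_map_def smult_monom)
  also have "\<dots> = (\<Sum>m\<in>A. monom (Poly_Mapping.lookup p m) (weight n m))"
    using assms by (intro sum.mono_neutral_left) (auto simp: in_keys_iff)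
  finally show ?thesis .
qed

lemma toric_map_zero [simp]: "toric_map n 0 = 0"
  by (simp add: toric_map_def)

lemma toric_map_add: "toric_map n (p + q) = toric_map n p + toric_map n q"
proof -
  let ?A = "Poly_Mapping.keys p \<union> Poly_Mapping.keys q"
  have "Poly_Mapping.keys (p + q) \<subseteq> ?A"
    by (rule keys_add)
  then show ?thesis
    by (simp add: toric_map_weight[of ?A] lookup_add add_monom[symmetric] sum.distrib)
qed

lemma toric_map_sum: "toric_map n (sum f A) = (\<Sum>x\<in>A. toric_map n (f x))"
  by (induction A rule: infinite_finite_induct) (simp_all add: toric_map_add)

lemma toric_map_single: "toric_map n (Poly_Mapping.single m c) = monom c (weight n m)"
  by (simp add: toric_map_weight[of "{m}"])

lemma toric_map_mult: "toric_map n (p * q) = toric_map n p * toric_map n q"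
proof -
  let ?s = "\<lambda>p m. Poly_Mapping.single m (Poly_Mapping.lookup p m)"
  have "toric_map n ((\<Sum>m\<in>Poly_Mapping.keys p. ?s p m) * (\<Sum>m\<in>Poly_Mapping.keys q. ?s q m))
      = (\<Sum>m\<in>Poly_Mapping.keys p. toric_map n (?s p m))
        * (\<Sum>m\<in>Poly_Mapping.keys q. toric_map n (?s q m))"
    by (simp add: sum_product toric_map_sum mult_single toric_map_single mult_monom weight_add)
  then show ?thesis
    by (simp flip: toric_map_sum poly_mapping_sum_singles)
qed

lemma ring_module: "module ((*) :: 'a::comm_ring_1 \<Rightarrow> 'a \<Rightarrow> 'a)"
  by standard (simp_all add: algebra_simps)

abbreviation is_ideal :: "'a::comm_ring_1 set \<Rightarrow> bool" where
  "is_ideal \<equiv> module.subspace (*)"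

lemmas is_idealI = module.subspaceI[OF ring_module]
  and ideal_zero = module.subspace_0[OF ring_module]
  and ideal_add = module.subspace_add[OF ring_module]
  and ideal_diff = module.subspace_diff[OF ring_module]
  and ideal_neg = module.subspace_neg[OF ring_module]
  and ideal_mult = module.subspace_scale[OF ring_module]
  and ideal_sum = module.subspace_sum[OF ring_module]
  and is_ideal_ideal_gen = module.subspace_span[OF ring_module, folded ideal_gen_def]
  and ideal_gen_base = module.span_base[OF ring_module, folded ideal_gen_def]
  and ideal_gen_minimal = module.span_minimal[OF ring_module, folded ideal_gen_def]

lemma is_ideal_toric_ideal: "is_ideal (toric_ideal n)"
  by (rule is_idealI) (simp_all add: toric_ideal_def toric_map_add toric_map_mult)

lemma binomial_in_toric_ideal_iff:
  "monomial u - monomial v \<in> toric_ideal n \<longleftrightarrow> weight n u = weight n v"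
proof -
  have "toric_map n (monomial u - monomial v) + toric_map n (monomial v) = toric_map n (monomial u)"
    by (simp flip: toric_map_add)
  then show ?thesis
    by (auto simp: toric_ideal_def monomial_def toric_map_single monom_eq_iff')
qed

lemma binomialI: "u \<noteq> v \<Longrightarrow> weight n u = weight n v \<Longrightarrow> monomial u - monomial v \<in> binomials n"
  by (auto simp: binomials_def binomial_in_toric_ideal_iff)

lemma binomials_uminus:
  assumes "f \<in> binomials n"
  shows "- f \<in> binomials n"
proof -
  obtain u v where f: "f = monomial u - monomial v" "u \<noteq> v" "weight n u = weight n v"
    using assms by (auto simp: binomials_def binomial_in_toric_ideal_iff)
  then show ?thesis
    using binomialI[of v u n] by simp
qed

text \<open>
  A polynomial in \<open>I\<^sub>S\<close> has, in each weight, coefficients with sum zero. Subtracting from every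
  monomial a fixed representative of its weight therefore does not change the polynomial, but
  writes it as a combination of binomials in \<open>I\<^sub>S\<close>.
\<close>

lemma toric_ideal_subset:
  assumes J: "is_ideal J"
    and bin: "\<And>u v. weight n u = weight n v \<Longrightarrow> monomial u - monomial v \<in> J"
  shows "toric_ideal n \<subseteq> J"
proof
  fix f :: "'a mpoly4"
  assume "f \<in> toric_ideal n"
  then have f0: "(\<Sum>m\<in>Poly_Mapping.keys f. monom (Poly_Mapping.lookup f m) (weight n m)) = 0"
    by (simp add: toric_ideal_def toric_map_weight[of "Poly_Mapping.keys f"])
  define r where "r d = (SOME m. weight n m = d)" for d
  define c :: "(4 \<Rightarrow>\<^sub>0 nat) \<Rightarrow> 'a mpoly4"
    where "c m = Poly_Mapping.single 0 (Poly_Mapping.lookup f m)" for m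
  let ?K = "Poly_Mapping.keys f"
  have r: "weight n (r (weight n m)) = weight n m" for m
    unfolding r_def by (rule someI) simp
  have coeff_sum_0: "(\<Sum>m | m \<in> ?K \<and> weight n m = d. Poly_Mapping.lookup f m) = 0" for d
    using arg_cong[OF f0, of "\<lambda>p. coeff p d"]
    by (simp add: coeff_sum sum.inter_filter)
  have single_sum: "Poly_Mapping.single 0 (sum g A) = (\<Sum>m\<in>A. Poly_Mapping.single 0 (g m))"
    for g :: "(4 \<Rightarrow>\<^sub>0 nat) \<Rightarrow> 'a" and A
    by (induction A rule: infinite_finite_induct) (simp_all add: single_add)
  have "(\<Sum>m | m \<in> ?K \<and> weight n m = d. c m) = 0" for d
    unfolding c_def single_sum[symmetric] coeff_sum_0 by (rule single_zero)
  then have "(\<Sum>d\<in>weight n ` ?K. \<Sum>m | m \<in> ?K \<and> weight n m = d. c m * monomial (r (weight n m))) = 0"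
    by (intro sum.neutral) (simp flip: sum_distrib_right)
  then have 0: "(\<Sum>m\<in>?K. c m * monomial (r (weight n m))) = 0"
    by (subst sum.image_gen[where g = "weight n"]) simp_all
  have "f = (\<Sum>m\<in>?K. c m * monomial m)"
    by (subst poly_mapping_sum_singles) (simp add: c_def monomial_def mult_single)
  also have "\<dots> = (\<Sum>m\<in>?K. c m * (monomial m - monomial (r (weight n m))))"
    using 0 by (simp add: right_diff_distrib sum_subtractf)
  also have "\<dots> \<in> J"
    by (intro ideal_sum[OF J] ideal_mult[OF J] bin) (simp add: r)
  finally show "f \<in> J" .
qed

section \<open>Two criteria for indispensability\<close>

lemma indispensable_uminus: "indispensable n f \<Longrightarrow> indispensable n (- f)"
  by (auto simp: indispensable_def binomials_uminus)

text \<open>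
  A subset of \<open>F\<close> that still generates and has least cardinality is a minimal generating set.
\<close>

lemma indispensable_in_generating_set:
  assumes "finite F" "F \<subseteq> binomials n" "ideal_gen F = toric_ideal n" "indispensable n f"
  shows "f \<in> up_to_sign F"
proof -
  let ?P = "\<lambda>G. G \<subseteq> F \<and> ideal_gen G = toric_ideal n"
  obtain G where G: "?P G" "\<And>G'. ?P G' \<Longrightarrow> card G \<le> card G'"
    using assms(3) ex_has_least_nat[of ?P F card] by blast
  have "ideal_gen G' \<noteq> toric_ideal n" if "G' \<subset> G" for G'
    using that G assms(1)
    by (metis finite_subset psubset_card_mono psubset_imp_subset subset_trans not_le)
  then have "minimal_binomial_gens n G"
    using G(1) assms(2) unfolding minimal_binomial_gens_def by blast
  then have "f \<in> G \<or> - f \<in> G"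
    using assms(4) unfolding indispensable_def by blast
  then show ?thesis
    using G(1) unfolding up_to_sign_def by (metis UnCI image_eqI minus_minus subsetD)
qed

text \<open>
  Suppose that a generating set \<open>G\<close> of binomials contains neither \<open>u - v\<close> nor \<open>v - u\<close>. If a
  monomial multiple of some \<open>p - q\<close> in \<open>G\<close> involved \<open>u\<close>, its other monomial would have the same
  weight and hence be \<open>v\<close>; the multiplier would divide \<open>u\<close> and \<open>v\<close>, so it would be 1 and
  \<open>p - q\<close> would be \<open>u - v\<close> or \<open>v - u\<close>. So the monomial \<open>u\<close> occurs in no element of the ideal
  generated by \<open>G\<close>, although it occurs in \<open>u - v\<close>.
\<close>

lemma indispensable_if_two_element_fibre:
  assumes "u \<noteq> v"
    and fibre: "\<And>m. weight n m = weight n u \<longleftrightarrow> m = u \<or> m = v"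
    and coprime: "\<And>w p q. w + p = u \<Longrightarrow> w + q = v \<Longrightarrow> w = 0"
  shows "indispensable n (monomial u - monomial v :: 'k::field mpoly4)"
proof -
  let ?f = "monomial u - monomial v :: 'k mpoly4"
  have wt: "weight n v = weight n u"
    using fibre by blast
  have "?f \<in> G \<or> - ?f \<in> G" if G: "minimal_binomial_gens n G" for G
  proof (rule ccontr)
    assume neg: "\<not> (?f \<in> G \<or> - ?f \<in> G)"
    \<comment> \<open>Polynomials without \<open>u\<close> do not form an ideal; the largest ideal among them is \<open>?V\<close>.\<close>
    let ?V = "{f :: 'k mpoly4. \<forall>a. Poly_Mapping.lookup (a * f) u = 0}"
    have V: "is_ideal ?V"
      by (rule is_idealI) (simp_all add: distrib_left lookup_add flip: mult.assoc)
    have "G \<subseteq> ?V"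
    proof
      fix g
      assume "g \<in> G"
      then have "g \<in> binomials n"
        using G by (auto simp: minimal_binomial_gens_def)
      then obtain p q where g: "g = monomial p - monomial q" "p \<noteq> q" "weight n p = weight n q"
        by (auto simp: binomials_def binomial_in_toric_ideal_iff)
      have "m + p \<noteq> u" for m
      proof
        assume p: "m + p = u"
        then have "weight n (m + q) = weight n u"
          using g(3) by (auto simp: weight_add)
        then have "m + q = v"
          using fibre p g(2) by auto
        then show False
          using coprime p g(1) neg \<open>g \<in> G\<close> by force
      qed
      moreover have "m + q \<noteq> u" for m
      proof
        assume q: "m + q = u"
        then have "weight n (m + p) = weight n u"
          using g(3) by (auto simp: weight_add)
        then have "m + p = v"
          using fibre q g(2) by auto
        then show False
          using coprime q g(1) neg \<open>g \<in> G\<close> by force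
      qed
      ultimately have "Poly_Mapping.lookup (Poly_Mapping.single m c * g) u = 0" for m c
        by (simp add: g(1) right_diff_distrib monomial_def mult_single lookup_minus lookup_single)
      then have "Poly_Mapping.lookup (a * g) u = 0" for a
        by (subst poly_mapping_sum_singles) (simp add: sum_distrib_right lookup_sum)
      then show "g \<in> ?V"
        by simp
    qed
    then have "ideal_gen G \<subseteq> ?V"
      using V by (rule ideal_gen_minimal)
    moreover have "?f \<in> ideal_gen G"
      using G wt by (simp add: minimal_binomial_gens_def binomial_in_toric_ideal_iff)
    ultimately have "Poly_Mapping.lookup (1 * ?f) u = 0"
      by blast
    then show False
      using assms(1) by (simp add: lookup_minus lookup_monomial)
  qed
  then show ?thesis
    using assms(1) wt
    by (auto simp: indispensable_def binomials_def binomial_in_toric_ideal_iff)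
qed

section \<open>Rewriting exponent vectors\<close>

definition reduction :: "((4 \<Rightarrow>\<^sub>0 nat) \<times> (4 \<Rightarrow>\<^sub>0 nat)) set \<Rightarrow> ((4 \<Rightarrow>\<^sub>0 nat) \<times> (4 \<Rightarrow>\<^sub>0 nat)) set" where
  "reduction R = {(l + m, r + m) | l r m. (l, r) \<in> R}"

lemma reductionI: "(l, r) \<in> R \<Longrightarrow> (l + m, r + m) \<in> reduction R"
  by (auto simp: reduction_def)

lemma reduction_weight:
  assumes "\<And>l r. (l, r) \<in> R \<Longrightarrow> weight n l = weight n r" "(u, v) \<in> (reduction R)\<^sup>*"
  shows "weight n u = weight n v"
  using assms(2) by induction (auto simp: reduction_def weight_add dest!: assms(1))

text \<open>
  One rewriting step replaces \<open>l m\<close> by \<open>r m\<close>, and \<open>l m - r m\<close> is a multiple of \<open>l - r\<close>; along a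
  chain of steps the differences telescope.
\<close>

lemma reduction_ideal:
  assumes J: "is_ideal J"
    and R: "\<And>l r. (l, r) \<in> R \<Longrightarrow> monomial l - monomial r \<in> J"
    and "(u, v) \<in> (reduction R)\<^sup>*"
  shows "monomial u - monomial v \<in> J"
  using assms(3)
proof induction
  case base
  then show ?case
    using ideal_zero[OF J] by simp
next
  case (step v w)
  then obtain l r m where *: "(l, r) \<in> R" "v = l + m" "w = r + m"
    by (auto simp: reduction_def)
  then have "monomial m * (monomial l - monomial r) \<in> J"
    using R ideal_mult[OF J] by blast
  then have "monomial v - monomial w \<in> J"
    by (simp add: * right_diff_distrib monomial_mult add.commute)
  then show ?case
    using ideal_add[OF J step.IH, of "monomial v - monomial w"] by simp
qed

text \<open>
  The exponent at \<open>i\<close> grows with each step but cannot exceed the weight, which is constant.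
\<close>

lemma reduction_terminates:
  assumes R: "\<And>l r. (l, r) \<in> R \<Longrightarrow>
      weight n l = weight n r \<and> Poly_Mapping.lookup l i < Poly_Mapping.lookup r i"
    and "n i > 0"
  shows "\<exists>v. (u, v) \<in> (reduction R)\<^sup>* \<and> v \<notin> Domain (reduction R)"
proof (induction "weight n u - Poly_Mapping.lookup u i" arbitrary: u rule: less_induct)
  case less
  show ?case
  proof (cases "u \<in> Domain (reduction R)")
    case True
    then obtain l r m where lr: "(l, r) \<in> R" and u: "u = l + m"
      by (auto simp: reduction_def)
    let ?v = "r + m"
    have uv: "(u, ?v) \<in> reduction R"
      unfolding u by (rule reductionI[OF lr])
    have "Poly_Mapping.lookup ?v i * n i \<le> weight n ?v"
      unfolding weight_def by (rule member_le_sum) auto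
    then have "Poly_Mapping.lookup ?v i \<le> weight n ?v"
      using assms(2) by (cases "n i") auto
    moreover have "weight n ?v = weight n u"
      using R[OF lr] by (simp add: u weight_add)
    moreover have "Poly_Mapping.lookup u i < Poly_Mapping.lookup ?v i"
      using R[OF lr] by (simp add: u lookup_add)
    ultimately have "weight n ?v - Poly_Mapping.lookup ?v i < weight n u - Poly_Mapping.lookup u i"
      by linarith
    from less[OF this] obtain w
      where "(?v, w) \<in> (reduction R)\<^sup>*" "w \<notin> Domain (reduction R)"
      by blast
    then show ?thesis
      using converse_rtrancl_into_rtrancl[OF uv] by blast
  next
    case False
    then show ?thesis
      by (intro exI[of _ u]) simp
  qed
qed

section \<open>The rewriting system of a pseudo symmetric semigroup\<close>

text \<open>
  Writing each parameter as its least value plus a natural number turns the formulas into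
  polynomials over the natural numbers without subtraction, so that the weights of
  the two sides of a rule can be compared by normalisation.
\<close>

lemma defining_integers_nat:
  assumes "defining_integers n \<alpha> s"
    and \<alpha>: "\<alpha> 1 = s + e + 2" "\<alpha> 2 = b + 2" "\<alpha> 3 = c + 2" "\<alpha> 4 = d + 2"
  shows "n 1 = (b + 2) * (c + 2) * (d + 1) + 1"
    "n 2 = s * (c + 2) * (d + 2) + (e + 1) * (c + 1) + (c + 2)"
    "n 3 = (s + e + 1) * (d + 2) + 1 + (e + 1) * (b + 1) * (d + 1)"
    "n 4 = (s + e + 2) * (b + 2) * (c + 1) + s * (b + 1) + (b + 2)"
proof -
  have D: "int (n 1) = int (\<alpha> 2) * int (\<alpha> 3) * (int (\<alpha> 4) - 1) + 1"
    "int (n 2) = int s * int (\<alpha> 3) * int (\<alpha> 4)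
       + (int (\<alpha> 1) - int s - 1) * (int (\<alpha> 3) - 1) + int (\<alpha> 3)"
    "int (n 3) = int (\<alpha> 1) * int (\<alpha> 4)
       + (int (\<alpha> 1) - int s - 1) * (int (\<alpha> 2) - 1) * (int (\<alpha> 4) - 1) - int (\<alpha> 4) + 1"
    "int (n 4) = int (\<alpha> 1) * int (\<alpha> 2) * (int (\<alpha> 3) - 1) + int s * (int (\<alpha> 2) - 1) + int (\<alpha> 2)"
    using assms(1) unfolding defining_integers_def Let_def by - (elim conjE, assumption)+
  have "int (n 1) = int ((b + 2) * (c + 2) * (d + 1) + 1)"
    "int (n 2) = int (s * (c + 2) * (d + 2) + (e + 1) * (c + 1) + (c + 2))"
    "int (n 3) = int ((s + e + 1) * (d + 2) + 1 + (e + 1) * (b + 1) * (d + 1))"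
    "int (n 4) = int ((s + e + 2) * (b + 2) * (c + 1) + s * (b + 1) + (b + 2))"
    unfolding D \<alpha> by (simp_all add: algebra_simps)
  then show "n 1 = (b + 2) * (c + 2) * (d + 1) + 1"
    "n 2 = s * (c + 2) * (d + 2) + (e + 1) * (c + 1) + (c + 2)"
    "n 3 = (s + e + 1) * (d + 2) + 1 + (e + 1) * (b + 1) * (d + 1)"
    "n 4 = (s + e + 2) * (b + 2) * (c + 1) + s * (b + 1) + (b + 2)"
    by (simp_all only: of_nat_eq_iff)
qed

text \<open>
  Here \<open>s\<close> stands for \<open>\<alpha>\<^sub>2\<^sub>1\<close>. The assumption on the gap makes the third rule below raise the
  exponent of \<open>X\<^sub>1\<close>.
\<close>

locale komeda =
  fixes n \<alpha> :: "4 \<Rightarrow> nat" and s :: nat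
  assumes gens_coprime: "Gcd (range n) = 1"
    and defining: "defining_integers n \<alpha> s"
    and gap: "s + 2 \<le> \<alpha> 1"
begin

lemma \<alpha>_gt_1: "\<alpha> i > 1"
  using defining by (simp add: defining_integers_def)

lemma komeda_params:
  obtains b c d e where
    "\<alpha> 1 = s + e + 2" "\<alpha> 2 = b + 2" "\<alpha> 3 = c + 2" "\<alpha> 4 = d + 2" "s > 0"
    "n 1 = (b + 2) * (c + 2) * (d + 1) + 1"
    "n 2 = s * (c + 2) * (d + 2) + (e + 1) * (c + 1) + (c + 2)"
    "n 3 = (s + e + 1) * (d + 2) + 1 + (e + 1) * (b + 1) * (d + 1)"
    "n 4 = (s + e + 2) * (b + 2) * (c + 1) + s * (b + 1) + (b + 2)"
proof -
  have gt: "2 \<le> \<alpha> i" for i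
    using \<alpha>_gt_1[of i] by simp
  define b c d e where "b = \<alpha> 2 - 2" and "c = \<alpha> 3 - 2" and "d = \<alpha> 4 - 2"
    and "e = \<alpha> 1 - s - 2"
  then have \<alpha>: "\<alpha> 1 = s + e + 2" "\<alpha> 2 = b + 2" "\<alpha> 3 = c + 2" "\<alpha> 4 = d + 2"
    using gap gt[of 2] gt[of 3] gt[of 4] by linarith+
  moreover have "s > 0"
    using defining by (simp add: defining_integers_def)
  ultimately show ?thesis
    using that defining_integers_nat[OF defining \<alpha>] by simp
qed

text \<open>
  The binomials \<open>-f\<^sub>1, f\<^sub>2, f\<^sub>3, f\<^sub>4, -f\<^sub>5\<close>, in this order, as rules oriented towards higher powers of
  \<open>X\<^sub>1\<close>.
\<close>

definition rules :: "((4 \<Rightarrow>\<^sub>0 nat) \<times> (4 \<Rightarrow>\<^sub>0 nat)) set" where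
  "rules =
    {(expo 0 0 1 (\<alpha> 4 - 1), expo (\<alpha> 1) 0 0 0),
     (expo 0 (\<alpha> 2) 0 0, expo s 0 0 1),
     (expo 0 0 (\<alpha> 3) 0, expo (\<alpha> 1 - s - 1) 1 0 0),
     (expo 0 0 0 (\<alpha> 4), expo 1 (\<alpha> 2 - 1) (\<alpha> 3 - 1) 0),
     (expo 0 1 0 (\<alpha> 4 - 1), expo (s + 1) 0 (\<alpha> 3 - 1) 0)}"

text \<open>
  The exponents of \<open>X\<^sub>2, X\<^sub>3, X\<^sub>4\<close> in the monomials that no left-hand side divides. As
  \<open>X\<^sub>2 X\<^sub>4^(\<alpha>\<^sub>4-1)\<close> and \<open>X\<^sub>3 X\<^sub>4^(\<alpha>\<^sub>4-1)\<close> are left-hand sides, the only one with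
  exponent \<open>\<alpha>\<^sub>4 - 1\<close> at \<open>X\<^sub>4\<close> is the pure power.
\<close>

definition standard :: "(nat \<times> nat \<times> nat) set" where
  "standard = {..<\<alpha> 2} \<times> {..<\<alpha> 3} \<times> {..<\<alpha> 4 - 1} \<union> {(0, 0, \<alpha> 4 - 1)}"

lemma rules_weight: "(l, r) \<in> rules \<Longrightarrow> weight n l = weight n r"
  by (rule komeda_params) (auto simp: rules_def weight_expo algebra_simps)

lemma rules_raise: "(l, r) \<in> rules \<Longrightarrow> Poly_Mapping.lookup l 1 = 0 \<and> Poly_Mapping.lookup r 1 > 0"
  by (rule komeda_params) (auto simp: rules_def)

lemma rule_binomial: "(l, r) \<in> rules \<Longrightarrow> monomial l - monomial r \<in> binomials n"
  using rules_weight rules_raise by (intro binomialI) force+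

lemma n1_pos: "n 1 > 0"
  by (rule komeda_params) simp

lemma card_standard: "card standard = n 1"
proof -
  have "card standard = \<alpha> 2 * (\<alpha> 3 * (\<alpha> 4 - 1)) + 1"
    unfolding standard_def by (subst card_Un_disjoint) (auto simp: card_cartesian_product)
  then show ?thesis
    by (rule_tac komeda_params) (simp add: algebra_simps)
qed

lemma irreducible_iff:
  "expo k a b c \<notin> Domain (reduction rules) \<longleftrightarrow> (a, b, c) \<in> standard"
proof
  assume irr: "expo k a b c \<notin> Domain (reduction rules)"
  have no: "l + m \<noteq> expo k a b c" if "l \<in> Domain rules" for l m
    using irr that reductionI by (metis Domain_iff)
  have "\<not> (c \<ge> \<alpha> 4 - 1 \<and> b \<ge> 1)"
    using no[of "expo 0 0 1 (\<alpha> 4 - 1)" "expo k a (b - 1) (c - (\<alpha> 4 - 1))"]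
    by (auto simp: rules_def)
  moreover have "\<not> (c \<ge> \<alpha> 4 - 1 \<and> a \<ge> 1)"
    using no[of "expo 0 1 0 (\<alpha> 4 - 1)" "expo k (a - 1) b (c - (\<alpha> 4 - 1))"]
    by (auto simp: rules_def)
  moreover have "\<not> a \<ge> \<alpha> 2"
    using no[of "expo 0 (\<alpha> 2) 0 0" "expo k (a - \<alpha> 2) b c"] by (auto simp: rules_def)
  moreover have "\<not> b \<ge> \<alpha> 3"
    using no[of "expo 0 0 (\<alpha> 3) 0" "expo k a (b - \<alpha> 3) c"] by (auto simp: rules_def)
  moreover have "\<not> c \<ge> \<alpha> 4"
    using no[of "expo 0 0 0 (\<alpha> 4)" "expo k a b (c - \<alpha> 4)"] by (auto simp: rules_def)
  ultimately show "(a, b, c) \<in> standard"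
    by (auto simp: standard_def)
next
  assume std: "(a, b, c) \<in> standard"
  show "expo k a b c \<notin> Domain (reduction rules)"
  proof
    assume "expo k a b c \<in> Domain (reduction rules)"
    then obtain l r m where lr: "(l, r) \<in> rules" and m: "expo k a b c = l + m"
      by (auto simp: reduction_def)
    obtain m1 m2 m3 m4 where "m = expo m1 m2 m3 m4"
      by (rule expo_cases)
    with lr m std show False
      by (rule_tac komeda_params) (auto simp: rules_def standard_def)
  qed
qed

text \<open>
  Bezout gives an integer combination of the generators with value \<open>r\<close>; modulo \<open>n\<^sub>1\<close> the
  multiple of \<open>n\<^sub>1\<close> drops out and the other coefficients can be made nonnegative.
\<close>

lemma residues_attained:
  assumes "r < n 1"
  shows "\<exists>a b c. weight n (expo 0 a b c) mod n 1 = r"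
proof -
  have "gcd (n 1) (gcd (n 2) (gcd (n 3) (n 4))) = 1"
    using gens_coprime by (simp add: UNIV_num4 Gcd_insert)
  then have g: "gcd (int (n 1)) (gcd (int (n 2)) (gcd (int (n 3)) (int (n 4)))) = 1"
    by (metis gcd_int_int_eq of_nat_1)
  obtain x3 x4 where x34: "x3 * int (n 3) + x4 * int (n 4) = gcd (int (n 3)) (int (n 4))"
    using bezout_int by blast
  obtain y2 y where y: "y2 * int (n 2) + y * gcd (int (n 3)) (int (n 4))
      = gcd (int (n 2)) (gcd (int (n 3)) (int (n 4)))"
    using bezout_int by blast
  obtain z1 z where z: "z1 * int (n 1) + z * gcd (int (n 2)) (gcd (int (n 3)) (int (n 4))) = 1"
    using bezout_int g by metis
  define w2 w3 w4 where w: "w2 = int r * z * y2" "w3 = int r * z * y * x3" "w4 = int r * z * y * x4"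
  have "z1 * int (n 1) + z * (y2 * int (n 2) + y * (x3 * int (n 3) + x4 * int (n 4))) = 1"
    using z unfolding y[symmetric] x34 .
  from arg_cong[OF this, of "\<lambda>t. int r * t"]
  have "int r * z1 * int (n 1) + (w2 * int (n 2) + w3 * int (n 3) + w4 * int (n 4)) = int r"
    unfolding w by (simp add: algebra_simps)
  then have "w2 * int (n 2) + w3 * int (n 3) + w4 * int (n 4)
      = int r + (- int r * z1) * int (n 1)"
    by simp
  then have eq: "(w2 * int (n 2) + w3 * int (n 3) + w4 * int (n 4)) mod int (n 1) = int r"
    using assms by (simp only: mod_mult_self1) simp
  let ?u = "\<lambda>w. nat (w mod int (n 1))"
  have "int (weight n (expo 0 (?u w2) (?u w3) (?u w4)) mod n 1) = int r"
  proof -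
    have "(w2 mod int (n 1) * int (n 2) + w3 mod int (n 1) * int (n 3)
        + w4 mod int (n 1) * int (n 4)) mod int (n 1) = int r"
      unfolding eq[symmetric] by (intro mod_add_cong mod_mult_cong) simp_all
    then show ?thesis
      using n1_pos by (simp add: weight_expo zmod_int)
  qed
  then show ?thesis
    using of_nat_eq_iff by blast
qed

lemma reduces_to_irreducible:
  "\<exists>v. (u, v) \<in> (reduction rules)\<^sup>* \<and> v \<notin> Domain (reduction rules)"
  by (rule reduction_terminates[where n = n and i = 1]) (auto simp: rules_weight rules_raise n1_pos)

text \<open>
  Every residue modulo \<open>n\<^sub>1\<close> is the weight of a monomial, and then also of an irreducible one.
  There are only \<open>n\<^sub>1\<close> irreducible monomials up to powers of \<open>X\<^sub>1\<close>, so their residues are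
  pairwise different, and the weight then determines the power of \<open>X\<^sub>1\<close> too.
\<close>

lemma irreducible_unique:
  assumes "u \<notin> Domain (reduction rules)" "v \<notin> Domain (reduction rules)"
    and w: "weight n u = weight n v"
  shows "u = v"
proof -
  define h where "h = (\<lambda>(a, b, c). weight n (expo 0 a b c) mod n 1)"
  have wt: "weight n (expo k a b c) = k * n 1 + weight n (expo 0 a b c)" for k a b c
    by (simp add: weight_expo)
  have h: "weight n (expo k a b c) mod n 1 = h (a, b, c)" for k a b c
    by (simp add: h_def wt[of k])
  have "{..<n 1} \<subseteq> h ` standard"
  proof
    fix r
    assume "r \<in> {..<n 1}"
    then obtain a b c where r: "weight n (expo 0 a b c) mod n 1 = r"
      using residues_attained by blast
    obtain x where x: "(expo 0 a b c, x) \<in> (reduction rules)\<^sup>*" "x \<notin> Domain (reduction rules)"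
      using reduces_to_irreducible by blast
    obtain k' a' b' c' where x': "x = expo k' a' b' c'"
      by (rule expo_cases)
    have "weight n x = weight n (expo 0 a b c)"
      using reduction_weight[OF rules_weight x(1)] by simp
    then have "h (a', b', c') = r"
      using r h by (metis x')
    moreover have "(a', b', c') \<in> standard"
      using x(2) by (simp add: x' irreducible_iff)
    ultimately show "r \<in> h ` standard"
      by blast
  qed
  moreover have "h ` standard \<subseteq> {..<n 1}"
    using n1_pos by (auto simp: h_def)
  ultimately have "h ` standard = {..<n 1}"
    by blast
  then have "card (h ` standard) = card standard"
    by (simp add: card_standard)
  moreover have "finite standard"
    by (simp add: standard_def)
  ultimately have inj: "inj_on h standard"
    by (simp add: eq_card_imp_inj_on)
  obtain k a b c where u: "u = expo k a b c"
    by (rule expo_cases)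
  obtain k' a' b' c' where v: "v = expo k' a' b' c'"
    by (rule expo_cases)
  have "h (a, b, c) = h (a', b', c')"
    using arg_cong[OF w, of "\<lambda>x. x mod n 1"] by (simp add: h u v)
  then have "(a, b, c) = (a', b', c')"
    using assms(1,2) inj by (auto simp: u v irreducible_iff dest: inj_onD)
  then show ?thesis
    using w n1_pos by (simp add: u v wt[of k] wt[of k'])
qed

lemma reduces_to_irreducible_of_same_weight:
  assumes "v \<notin> Domain (reduction rules)" "weight n u = weight n v"
  shows "(u, v) \<in> (reduction rules)\<^sup>*"
  using assms irreducible_unique reduces_to_irreducible reduction_weight[OF rules_weight] by metis

text \<open>
  Two monomials of the same weight rewrite to a common irreducible monomial, so their difference
  lies in the ideal generated by the rules.
\<close>

lemma toric_ideal_generated: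
  fixes F :: "'k::field mpoly4 set"
  assumes F: "F \<subseteq> toric_ideal n"
    and gen: "\<And>l r. (l, r) \<in> rules \<Longrightarrow> monomial l - monomial r \<in> ideal_gen F"
  shows "ideal_gen F = toric_ideal n"
proof
  show "ideal_gen F \<subseteq> toric_ideal n"
    using F is_ideal_toric_ideal by (rule ideal_gen_minimal)
  show "toric_ideal n \<subseteq> ideal_gen F"
  proof (rule toric_ideal_subset)
    show sub: "is_ideal (ideal_gen F)"
      by (rule is_ideal_ideal_gen)
    fix u v
    assume w: "weight n u = weight n v"
    obtain x where x: "(v, x) \<in> (reduction rules)\<^sup>*" "x \<notin> Domain (reduction rules)"
      using reduces_to_irreducible by blast
    then have "(u, x) \<in> (reduction rules)\<^sup>*"
      using w reduction_weight[OF rules_weight x(1)]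
      by (intro reduces_to_irreducible_of_same_weight) auto
    then have "monomial u - monomial x \<in> ideal_gen F" "monomial v - monomial x \<in> ideal_gen F"
      using x(1) by (auto intro: reduction_ideal[OF sub gen])
    then show "monomial u - monomial v \<in> ideal_gen F"
      using ideal_diff[OF sub, of "monomial u - monomial x" "monomial v - monomial x"]
      by simp
  qed
qed

lemma rule_rhs_irreducible:
  assumes "(l, r) \<in> rules"
  shows "r \<notin> Domain (reduction rules)"
proof -
  have "(0, 0, 0) \<in> standard" "(0, 0, 1) \<in> standard" "(1, 0, 0) \<in> standard"
    "(\<alpha> 2 - 1, \<alpha> 3 - 1, 0) \<in> standard" "(0, \<alpha> 3 - 1, 0) \<in> standard"
    by (rule komeda_params, auto simp: standard_def)+
  then have "\<exists>k a b c. r = expo k a b c \<and> (a, b, c) \<in> standard"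
    using assms unfolding rules_def by auto
  then show ?thesis
    using irreducible_iff by blast
qed

lemma rule_coprime:
  assumes "(l, r) \<in> rules" "w + p = l" "w + q = r"
  shows "w = 0"
proof -
  obtain w1 w2 w3 w4 where w: "w = expo w1 w2 w3 w4"
    by (rule expo_cases)
  obtain p1 p2 p3 p4 where p: "p = expo p1 p2 p3 p4"
    by (rule expo_cases)
  obtain q1 q2 q3 q4 where q: "q = expo q1 q2 q3 q4"
    by (rule expo_cases)
  have "w1 = 0 \<and> w2 = 0 \<and> w3 = 0 \<and> w4 = 0"
    using assms by (auto simp: rules_def w p q)
  then show ?thesis
    by (simp add: w)
qed

text \<open>
  Only its own rule produces the right-hand side of a rule, as comparing exponents shows. The one
  exception is \<open>X\<^sub>1 X\<^sub>2^(\<alpha>\<^sub>2-1) X\<^sub>3^(\<alpha>\<^sub>3-1)\<close>: the third right-hand side,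
  \<open>X\<^sub>1^(\<alpha>\<^sub>1-\<alpha>\<^sub>2\<^sub>1-1) X\<^sub>2\<close>, divides it when \<open>\<alpha>\<^sub>1 - \<alpha>\<^sub>2\<^sub>1 = 2\<close>.
\<close>

lemma rule_rhs_unique:
  assumes "(l, r) \<in> rules" "(l', r') \<in> rules" "r' + m = r"
    and "\<alpha> 1 - s > 2 \<or> r \<noteq> expo 1 (\<alpha> 2 - 1) (\<alpha> 3 - 1) 0"
  shows "l' + m = l"
proof -
  obtain m1 m2 m3 m4 where "m = expo m1 m2 m3 m4"
    by (rule expo_cases)
  with assms show ?thesis
    by (rule_tac komeda_params) (auto simp: rules_def)
qed

text \<open>
  A monomial of the same weight as \<open>r\<close> rewrites to \<open>r\<close>. The last step of the chain starts at
  \<open>l\<close>, and no step ends at \<open>l\<close>, because every right-hand side contains \<open>X\<^sub>1\<close> and \<open>l\<close> does not.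
\<close>

lemma rule_indispensable:
  assumes lr: "(l, r) \<in> rules"
    and "\<alpha> 1 - s > 2 \<or> r \<noteq> expo 1 (\<alpha> 2 - 1) (\<alpha> 3 - 1) 0"
  shows "indispensable n (monomial l - monomial r :: 'k::field mpoly4)"
proof (rule indispensable_if_two_element_fibre)
  show "l \<noteq> r"
    using rules_raise[OF lr] by auto
  show "w = 0" if "w + p = l" "w + q = r" for w p q
    using rule_coprime[OF lr that] .
  show "weight n m = weight n l \<longleftrightarrow> m = l \<or> m = r" for m
  proof
    assume "weight n m = weight n l"
    then have "(m, r) \<in> (reduction rules)\<^sup>*"
      using rules_weight[OF lr] rule_rhs_irreducible[OF lr]
      by (intro reduces_to_irreducible_of_same_weight) auto
    then show "m = l \<or> m = r"
    proof (cases rule: rtranclE)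
      case (step y)
      have "y = l"
        using step(2) rule_rhs_unique[OF lr _ _ assms(2)] by (auto simp: reduction_def)
      have "(x, l) \<notin> reduction rules" for x
        using rules_raise[OF lr] rules_raise by (fastforce simp: reduction_def lookup_add)
      then show ?thesis
        using step(1) \<open>y = l\<close> by (metis rtranclE)
    qed simp
  qed (use rules_weight[OF lr] in auto)
qed

end

section \<open>The indispensable binomials\<close>

theorem corollary2p4:
  fixes n \<alpha> :: "4 \<Rightarrow> nat" and \<alpha>21 :: nat
    and f1 f2 f3 f4 f5 :: "'k::field mpoly4"
  assumes "four_generated n"
    and "pseudo_symmetric (numerical_semigroup n)"
    and "defining_integers n \<alpha> \<alpha>21"
    and "f1 = X 1 ^ \<alpha> 1 - X 3 * X 4 ^ (\<alpha> 4 - 1)"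
    and "f2 = X 2 ^ \<alpha> 2 - X 1 ^ \<alpha>21 * X 4"
    and "f3 = X 3 ^ \<alpha> 3 - X 1 ^ (\<alpha> 1 - \<alpha>21 - 1) * X 2"
    and "f4 = X 4 ^ \<alpha> 4 - X 1 * X 2 ^ (\<alpha> 2 - 1) * X 3 ^ (\<alpha> 3 - 1)"
    and "f5 = X 3 ^ (\<alpha> 3 - 1) * X 1 ^ (\<alpha>21 + 1) - X 2 * X 4 ^ (\<alpha> 4 - 1)"
  shows "(\<alpha> 1 - \<alpha>21 > 2 \<longrightarrow>
            {f :: 'k mpoly4. indispensable n f} = up_to_sign {f1, f2, f3, f4, f5}) \<and>
         (\<alpha> 1 - \<alpha>21 = 2 \<longrightarrow>
            {f :: 'k mpoly4. indispensable n f} = up_to_sign {f1, f2, f3, f5})"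
proof (cases "\<alpha>21 + 2 \<le> \<alpha> 1")
  case True
  interpret komeda n \<alpha> \<alpha>21
    using assms(1,3) True by unfold_locales (simp_all add: four_generated_def)
  let ?M = "\<lambda>a b c d. monomial (expo a b c d) :: 'k mpoly4"
  have f_eq: "f1 = ?M (\<alpha> 1) 0 0 0 - ?M 0 0 1 (\<alpha> 4 - 1)"
    "f2 = ?M 0 (\<alpha> 2) 0 0 - ?M \<alpha>21 0 0 1"
    "f3 = ?M 0 0 (\<alpha> 3) 0 - ?M (\<alpha> 1 - \<alpha>21 - 1) 1 0 0"
    "f4 = ?M 0 0 0 (\<alpha> 4) - ?M 1 (\<alpha> 2 - 1) (\<alpha> 3 - 1) 0"
    "f5 = ?M (\<alpha>21 + 1) 0 (\<alpha> 3 - 1) 0 - ?M 0 1 0 (\<alpha> 4 - 1)"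
    unfolding assms(4-8) X_power
    by (simp_all add: X_def monomial_mult expo_def add.commute)
  have rule_cases: "monomial l - monomial r \<in> {- f1, f2, f3, f4, - f5}"
    if "(l, r) \<in> rules" for l r
    using that unfolding rules_def f_eq by auto
  have "- f1 \<in> binomials n" "f2 \<in> binomials n" "f3 \<in> binomials n" "f4 \<in> binomials n"
    "- f5 \<in> binomials n"
    unfolding f_eq minus_diff_eq by (rule rule_binomial, simp add: rules_def)+
  then have bin: "{f1, f2, f3, f4, f5} \<subseteq> binomials n"
    using binomials_uminus[of "- f1" n] binomials_uminus[of "- f5" n] by auto
  have "indispensable n (- f1)" "indispensable n f2" "indispensable n f3" "indispensable n (- f5)"
    unfolding f_eq minus_diff_eq
    by (rule rule_indispensable; use \<alpha>_gt_1[of 2] \<alpha>_gt_1[of 3] in \<open>auto simp: rules_def\<close>)+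
  then have indisp: "indispensable n g" if "g \<in> up_to_sign {f1, f2, f3, f5}" for g
    using that indispensable_uminus[of n] unfolding up_to_sign_def by force
  have gen: "ideal_gen F = toric_ideal n"
    if "F \<subseteq> toric_ideal n" "{f1, f2, f3, f4, f5} \<subseteq> ideal_gen F" for F :: "'k mpoly4 set"
  proof (rule toric_ideal_generated[OF that(1)])
    fix l r
    assume "(l, r) \<in> rules"
    then have "monomial l - monomial r \<in> {- f1, f2, f3, f4, - f5}"
      by (rule rule_cases)
    moreover have "{- f1, f2, f3, f4, - f5} \<subseteq> ideal_gen F"
      using that(2) by (simp add: ideal_neg is_ideal_ideal_gen)
    ultimately show "monomial l - monomial r \<in> ideal_gen F"
      by (rule rev_subsetD)
  qed
  have subset: "f \<in> up_to_sign {f1, f2, f3, f4, f5}" if "indispensable n f" for f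
  proof (rule indispensable_in_generating_set[OF _ bin _ that])
    show "ideal_gen {f1, f2, f3, f4, f5} = toric_ideal n"
      using bin by (intro gen) (auto simp: binomials_def intro: ideal_gen_base)
  qed simp
  show ?thesis
  proof (intro conjI impI)
    assume "\<alpha> 1 - \<alpha>21 > 2"
    then have "indispensable n f4"
      unfolding f_eq by (intro rule_indispensable) (auto simp: rules_def)
    then have "indispensable n g" if "g \<in> up_to_sign {f1, f2, f3, f4, f5}" for g
      using that indisp indispensable_uminus[of n f4] unfolding up_to_sign_def by auto
    then show "{f :: 'k mpoly4. indispensable n f} = up_to_sign {f1, f2, f3, f4, f5}"
      using subset by blast
  next
    assume gap2: "\<alpha> 1 - \<alpha>21 = 2"
    \<comment> \<open>The replacement for \<open>f4\<close>, obtained by applying \<open>f3\<close> to its second monomial.\<close>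
    define g where "g = ?M 0 0 0 (\<alpha> 4) - ?M 0 (\<alpha> 2 - 2) (2 * \<alpha> 3 - 1) 0"
    let ?w = "?M 1 (\<alpha> 2 - 1) (\<alpha> 3 - 1) 0" and ?h = "?M 0 (\<alpha> 2 - 2) (\<alpha> 3 - 1) 0"
    have ge2: "2 \<le> \<alpha> i" for i
      using \<alpha>_gt_1[of i] by simp
    have "?h * ?M 0 0 (\<alpha> 3) 0 = ?M 0 (\<alpha> 2 - 2) (2 * \<alpha> 3 - 1) 0"
      using ge2[of 3] by (simp add: monomial_mult mult_2)
    moreover have "?h * ?M 1 1 0 0 = ?w"
      using ge2[of 2] by (simp add: monomial_mult Suc_diff_Suc numeral_2_eq_2)
    ultimately have f4: "f4 = g + ?h * f3"
      using gap2 by (simp add: f_eq g_def right_diff_distrib)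
    have g: "g \<in> binomials n"
    proof -
      have "g = f4 - ?h * f3"
        by (simp add: f4)
      also have "\<dots> \<in> toric_ideal n"
        using bin by (intro ideal_diff ideal_mult is_ideal_toric_ideal) (auto simp: binomials_def)
      finally show ?thesis
        using ge2[of 4] unfolding g_def binomials_def by fastforce
    qed
    have not_g: "f4 \<noteq> g" "f4 \<noteq> - g"
    proof -
      \<comment> \<open>The second monomial of \<open>f4\<close> contains \<open>X\<^sub>1\<close>, so it does not occur in \<open>g\<close>.\<close>
      let ?c = "\<lambda>p. Poly_Mapping.lookup p (expo 1 (\<alpha> 2 - 1) (\<alpha> 3 - 1) 0)"
      have "?c f4 = - 1" "?c g = 0"
        by (auto simp: f_eq g_def lookup_minus lookup_monomial)
      then show "f4 \<noteq> g" "f4 \<noteq> - g"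
        by auto
    qed
    have "f \<in> up_to_sign {f1, f2, f3, f5}" if f: "indispensable n f" for f
    proof -
      let ?F = "{f1, f2, f3, f5, g}"
      have F: "?F \<subseteq> binomials n"
        using bin g by auto
      have f4_in: "f4 \<in> ideal_gen ?F"
        unfolding f4 by (intro ideal_add ideal_mult is_ideal_ideal_gen ideal_gen_base) auto
      have "ideal_gen ?F = toric_ideal n"
        using F f4_in by (intro gen) (auto simp: binomials_def intro: ideal_gen_base)
      then have "f \<in> up_to_sign ?F"
        using indispensable_in_generating_set[OF _ F _ f] by simp
      then show ?thesis
        using subset[OF f] not_g by (auto simp: up_to_sign_def)
    qed
    then show "{f :: 'k mpoly4. indispensable n f} = up_to_sign {f1, f2, f3, f5}"
      using indisp by blast
  qed
  \<comment> \<open>Otherwise \<open>\<alpha>\<^sub>1 - \<alpha>\<^sub>2\<^sub>1 < 2\<close>, and both implications hold vacuously.\<close>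
qed auto

end
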